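(* Let $\mathfrak g=\mathfrak{sp}_{2r}(\mathbb C)$ with $r\ge 3$, and let $\lambda=\alpha_1+\alpha_2+\cdots+\alpha_r$ be the sum of its simple roots. Then $\sigma\in\mathcal A(\lambda,0)$ if and only if one of the following holds: (1) $\sigma=1$; or (2) $\sigma=s_{i_1}s_{i_2}\cdots s_{i_k}$ for some nonconsecutive integers $2\le i_1,i_2,\ldots,i_k\le r-1$; or (3) $\sigma=s_{i_1}s_{i_2}\cdots s_{i_k}\pi$ for some (possibly empty) collection of nonconsecutive integers $2\le i_1,i_2,\ldots,i_k\le r-4$ and some $\pi\in\{s_{r-2}s_{r-1},\ s_{r-1}s_{r-2},\ s_{r-2}s_{r-1}s_{r-2}\}$.
   Context: Let $\varepsilon_1,\ldots,\varepsilon_r$ be the standard basis of $\mathbb R^r$. The simple roots of $\mathfrak{sp}_{2r}(\mathbb C)$ are $\alpha_i=\varepsilon_i-\varepsilon_{i+1}$ for $1\le i\le r-1$ and $\alpha_r=2\varepsilon_r$; the positive roots are $\Phi^+=\{\varepsilon_i-\varepsilon_j,\ \varepsilon_i+\varepsilon_j:1\le i<j\le r\}\cup\{2\varepsilon_i:1\le i\le r\}$. Set $\rho=\frac12\sum_{\alpha\in\Phi^+}\alpha$. The Weyl group $W$ is generated by the simple reflections $s_i$ in the hyperplanes orthogonal to $\alpha_i$, $1\le i\le r$. Kostant's partition function $\wp(\xi)$ is the number of ways to write $\xi$ as a nonnegative integral linear combination of positive roots (so $\wp(0)=1$). For integral weights $\lambda,\mu$ (not necessarily dominant), the Weyl alternation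 set is $\mathcal A(\lambda,\mu)=\{\sigma\in W:\wp(\sigma(\lambda+\rho)-(\mu+\rho))>0\}$. Integers $i_1,\ldots,i_k$ are nonconsecutive if $|i_a-i_b|\ge 2$ for all $a\ne b$.
   Formalization: Case (3) is allowed only for r ≥ 4: for r = 3 the claim as stated fails, since the empty collection would put s_1s_2 in A(λ,0), yet s_1s_2(λ+ρ)−ρ = (−1,2,1) has ℘ = 0; for r = 3 the formal theorem gives exactly cases (1) and (2). *)

theory Defs
  imports
    "HOL-Analysis.Analysis"
    "HOL-Algebra.Bij"
    "HOL-Algebra.Generated_Groups"
begin

text \<open>
  The root system of type \<open>C\<^sub>r\<close>.  The standard basis
  \<open>\<epsilon> 1, \<dots>, \<epsilon> r\<close> of the ambient Euclidean space is passed as a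
  parameter \<open>\<epsilon>\<close>: an enumeration of \<^term>\<open>Basis\<close> by \<open>{1..r}\<close>
  (so \<open>r\<close> is the dimension of the space).
\<close>

definition std_basis :: "nat \<Rightarrow> (nat \<Rightarrow> 'a::euclidean_space) \<Rightarrow> bool" where
  "std_basis r \<epsilon> \<longleftrightarrow> bij_betw \<epsilon> {1..r} Basis"

definition simple_root :: "nat \<Rightarrow> (nat \<Rightarrow> 'a::euclidean_space) \<Rightarrow> nat \<Rightarrow> 'a" where
  "simple_root r \<epsilon> i = (if i < r then \<epsilon> i - \<epsilon> (i + 1) else 2 *\<^sub>R \<epsilon> r)"

definition positive_roots :: "nat \<Rightarrow> (nat \<Rightarrow> 'a::euclidean_space) \<Rightarrow> 'a set" where
  "positive_roots r \<epsilon> =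
     {\<epsilon> i - \<epsilon> j | i j. 1 \<le> i \<and> i < j \<and> j \<le> r} \<union>
     {\<epsilon> i + \<epsilon> j | i j. 1 \<le> i \<and> i < j \<and> j \<le> r} \<union>
     {2 *\<^sub>R \<epsilon> i | i. 1 \<le> i \<and> i \<le> r}"

definition weyl_vector :: "nat \<Rightarrow> (nat \<Rightarrow> 'a::euclidean_space) \<Rightarrow> 'a" where
  "weyl_vector r \<epsilon> = (1 / 2) *\<^sub>R (\<Sum>\<alpha>\<in>positive_roots r \<epsilon>. \<alpha>)"

definition hyperplane_reflection :: "'a::euclidean_space \<Rightarrow> 'a \<Rightarrow> 'a" where
  "hyperplane_reflection \<alpha> v = v - (2 * (v \<bullet> \<alpha>) / (\<alpha> \<bullet> \<alpha>)) *\<^sub>R \<alpha>"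

definition simple_reflection ::
    "nat \<Rightarrow> (nat \<Rightarrow> 'a::euclidean_space) \<Rightarrow> nat \<Rightarrow> 'a \<Rightarrow> 'a" where
  "simple_reflection r \<epsilon> i = hyperplane_reflection (simple_root r \<epsilon> i)"

text \<open>
  Weyl group elements are bijections of the ambient space;
  \<^term>\<open>BijGroup UNIV\<close> is the group of all such bijections under composition.
\<close>

definition weyl_group :: "nat \<Rightarrow> (nat \<Rightarrow> 'a::euclidean_space) \<Rightarrow> ('a \<Rightarrow> 'a) set" where
  "weyl_group r \<epsilon> = generate (BijGroup UNIV) (simple_reflection r \<epsilon> ` {1..r})"

text \<open>
  The set of multiplicity functions below is finite, because the positive roots
  lie in an open half-space; hence \<^term>\<open>card\<close> has its intended meaning.
\<close>

definition partition_function ::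
    "nat \<Rightarrow> (nat \<Rightarrow> 'a::euclidean_space) \<Rightarrow> 'a \<Rightarrow> nat" where
  "partition_function r \<epsilon> \<xi> =
     card {c \<in> positive_roots r \<epsilon> \<rightarrow>\<^sub>E (UNIV :: nat set).
             (\<Sum>\<alpha>\<in>positive_roots r \<epsilon>. real (c \<alpha>) *\<^sub>R \<alpha>) = \<xi>}"

definition alternation_set ::
    "nat \<Rightarrow> (nat \<Rightarrow> 'a::euclidean_space) \<Rightarrow> 'a \<Rightarrow> 'a \<Rightarrow> ('a \<Rightarrow> 'a) set" where
  "alternation_set r \<epsilon> lam mu =
     {\<sigma> \<in> weyl_group r \<epsilon>.
        partition_function r \<epsilon> (\<sigma> (lam + weyl_vector r \<epsilon>) - (mu + weyl_vector r \<epsilon>)) > 0}"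

text \<open>
  \<open>refl_word r \<epsilon> [i, j, \<dots>, k]\<close> is the product \<open>s i \<circ> s j \<circ> \<dots> \<circ> s k\<close>
  of simple reflections, so the last entry of the list acts first.
\<close>

definition refl_word ::
    "nat \<Rightarrow> (nat \<Rightarrow> 'a::euclidean_space) \<Rightarrow> nat list \<Rightarrow> 'a \<Rightarrow> 'a" where
  "refl_word r \<epsilon> is = foldr (\<lambda>i w. simple_reflection r \<epsilon> i \<circ> w) is id"

definition nonconsecutive :: "nat list \<Rightarrow> bool" where
  "nonconsecutive is \<longleftrightarrow>
     (\<forall>a < length is. \<forall>b < length is.
        a \<noteq> b \<longrightarrow> \<bar>int (is ! a) - int (is ! b)\<bar> \<ge> 2)"

end

theory Submission
  imports Defs
begin

text \<open>
  Write \<open>\<rho> = (r, r - 1, \<dots>, 1)\<close>.  Since \<open>\<lambda> = \<epsilon>\<^sub>1 + \<epsilon>\<^sub>r\<close>, the shifted weight is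
  \<open>\<lambda> + \<rho> = (r + 1, r - 1, r - 2, \<dots>, 3, 2, 2)\<close>.  The coefficients of a vector \<open>\<xi>\<close> in the simple
  roots are its partial coordinate sums, the last one halved.  Hence \<open>\<wp>(\<xi>) > 0\<close> forces all partial
  sums to be nonnegative, and the converse holds when they are integers and the total is even.
  So \<open>\<sigma>\<close> lies in the alternation set exactly if every partial sum of \<open>\<sigma>(\<lambda> + \<rho>)\<close> is at least the
  corresponding partial sum of \<open>\<rho>\<close>; call this dominance.
  
  Weyl group elements permute coordinates and change signs.  The total of \<open>\<lambda> + \<rho>\<close> exceeds that of
  \<open>\<rho>\<close> by only 2, whereas making an entry negative costs at least 4; so a dominating \<open>\<sigma>\<close> is a
  permutation.  The first entry of \<open>\<sigma>(\<lambda> + \<rho>)\<close> must be \<open>r + 1\<close>, which leaves a surplus of 1.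
  Reading on from left to right with surplus 1, the next entry is either the one already there,
  which preserves the surplus, or the next smaller one, which uses it up.  In the second case
  the following entry must be the one that was skipped, so \<open>\<sigma>\<close> begins with an adjacent swap,
  and the surplus is 1 again.  This yields products of nonconsecutive simple reflections.
  The only deviation occurs, for \<open>r \<ge> 4\<close>, at the last three entries \<open>3, 2, 2\<close>: because the entry 2 is repeated,
  every permutation of these positions is allowed, and the three permutations in the
  symmetric group on these positions which are not products of nonconsecutive reflections
  are \<open>s\<^sub>r\<^sub>-\<^sub>2 s\<^sub>r\<^sub>-\<^sub>1\<close>, \<open>s\<^sub>r\<^sub>-\<^sub>1 s\<^sub>r\<^sub>-\<^sub>2\<close> and \<open>s\<^sub>r\<^sub>-\<^sub>2 s\<^sub>r\<^sub>-\<^sub>1 s\<^sub>r\<^sub>-\<^sub>2\<close>.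
  
  The lemmas that carry this are \<open>partition_function_pos_iff\<close>, \<open>dominates_imp_perm_action\<close>,
  \<open>dominates_imp_listed\<close> and, for the converse, \<open>psum_word\<close> and \<open>listed_imp_dominates\<close>.
\<close>

section \<open>Coordinates and partial sums\<close>

locale type_C =
  fixes r :: nat and \<epsilon> :: "nat \<Rightarrow> 'a::euclidean_space"
  assumes std: "std_basis r \<epsilon>" and r3: "3 \<le> r"
begin

definition psum :: "nat \<Rightarrow> 'a \<Rightarrow> real" where
  "psum m y = (\<Sum>i = 1..m. y \<bullet> \<epsilon> i)"

lemma inner_basis [simp]:
  assumes "i \<in> {1..r}" "j \<in> {1..r}"
  shows "\<epsilon> i \<bullet> \<epsilon> j = (if i = j then 1 else 0)"
proof -
  have bij: "bij_betw \<epsilon> {1..r} Basis" using std unfolding std_basis_def .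
  then have "\<epsilon> i \<in> Basis" "\<epsilon> j \<in> Basis" using assms by (metis bij_betwE)+
  moreover have "\<epsilon> i = \<epsilon> j \<longleftrightarrow> i = j"
    using bij assms by (metis bij_betw_inv_into_left)
  ultimately show ?thesis by (simp add: inner_Basis)
qed

lemma coord_eqI:
  assumes "\<And>i. i \<in> {1..r} \<Longrightarrow> y \<bullet> \<epsilon> i = z \<bullet> \<epsilon> i"
  shows "y = z"
proof (rule euclidean_eqI)
  fix b :: 'a assume "b \<in> Basis"
  then obtain i where "i \<in> {1..r}" "b = \<epsilon> i"
    using std unfolding std_basis_def bij_betw_def by blast
  then show "y \<bullet> b = z \<bullet> b" using assms by simp
qed

lemma psum_0 [simp]: "psum 0 y = 0" by (simp add: psum_def)

lemma psum_Suc [simp]: "psum (Suc m) y = psum m y + y \<bullet> \<epsilon> (Suc m)"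
  by (simp add: psum_def)

lemma psum_linear [simp]:
  "psum m (y + z) = psum m y + psum m z"
  "psum m (y - z) = psum m y - psum m z"
  "psum m (c *\<^sub>R y) = c * psum m y"
  "psum m (\<Sum>a\<in>A. f a) = (\<Sum>a\<in>A. psum m (f a))"
  by (simp_all add: psum_def inner_left_distrib inner_diff_left sum.distrib
      sum_subtractf sum_distrib_left inner_sum_left sum.swap[of _ A])

lemma psum_eqI:
  assumes "\<And>m. m \<in> {1..r} \<Longrightarrow> psum m y = psum m z"
  shows "y = z"
proof (rule coord_eqI)
  fix i assume i: "i \<in> {1..r}"
  then obtain j where j: "i = Suc j" by (cases i) auto
  have "psum j y = psum j z" using i j assms[of j] by (cases "j = 0") (auto simp del: psum_Suc)
  with assms[OF i] j show "y \<bullet> \<epsilon> i = z \<bullet> \<epsilon> i" by simp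
qed

lemma psum_basis:
  assumes "i \<in> {1..r}" "m \<le> r"
  shows "psum m (\<epsilon> i) = (if i \<le> m then 1 else 0)"
proof -
  have "psum m (\<epsilon> i) = (\<Sum>j = 1..m. if i = j then 1 else 0)"
    unfolding psum_def using assms by (intro sum.cong) auto
  then show ?thesis using assms by auto
qed

text \<open>
  The functionals \<open>psum m\<close> are, up to the factor 2 at \<open>m = r\<close>, the dual basis of the simple roots.
\<close>

lemma psum_simple_root:
  assumes "i \<in> {1..r}" "m \<le> r"
  shows "psum m (simple_root r \<epsilon> i) = (if m = i then if i = r then 2 else 1 else 0)"
  using assms by (auto simp: simple_root_def psum_basis)

section \<open>The shifted weight\<close>

text \<open>
  The long roots \<open>2\<epsilon>\<^sub>i\<close> are the case \<open>i = j\<close> of \<open>\<epsilon>\<^sub>i + \<epsilon>\<^sub>j\<close>, which leaves two injectively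
  parametrised and disjoint families.
\<close>

lemma positive_roots_eq:
  "positive_roots r \<epsilon> =
     (\<lambda>(i, j). \<epsilon> i - \<epsilon> j) ` {(i, j). 1 \<le> i \<and> i < j \<and> j \<le> r} \<union>
     (\<lambda>(i, j). \<epsilon> i + \<epsilon> j) ` {(i, j). 1 \<le> i \<and> i \<le> j \<and> j \<le> r}"
  unfolding positive_roots_def by (fastforce simp: scaleR_2 le_less)

lemma finite_positive_roots: "finite (positive_roots r \<epsilon>)"
proof -
  have "finite {(i, j). 1 \<le> i \<and> i < j \<and> j \<le> r}" "finite {(i, j). 1 \<le> i \<and> i \<le> j \<and> j \<le> r}"
    by (rule finite_subset[of _ "{1..r} \<times> {1..r}"]; auto)+
  then show ?thesis unfolding positive_roots_eq by blast
qed

text \<open>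
  For \<open>i < j\<close> the roots \<open>\<epsilon>\<^sub>i - \<epsilon>\<^sub>j\<close> and \<open>\<epsilon>\<^sub>i + \<epsilon>\<^sub>j\<close> add up to \<open>2\<epsilon>\<^sub>i\<close>; with the long root this
  gives \<open>2\<epsilon>\<^sub>i\<close> once for every \<open>j\<close> in \<open>{i..r}\<close>.
\<close>

lemma weyl_vector_eq: "weyl_vector r \<epsilon> = (\<Sum>i = 1..r. real (r + 1 - i) *\<^sub>R \<epsilon> i)"
proof -
  let ?A = "{(i, j). 1 \<le> i \<and> i < j \<and> j \<le> r}" and ?D = "(\<lambda>i. (i, i)) ` {1..r}"
  let ?B = "{(i, j). 1 \<le> i \<and> i \<le> j \<and> j \<le> r}"
  let ?f = "\<lambda>(i, j). \<epsilon> i - \<epsilon> j" and ?g = "\<lambda>(i, j). \<epsilon> i + \<epsilon> j"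
  have finA: "finite ?A" and finB: "finite ?B"
    by (rule finite_subset[of _ "{1..r} \<times> {1..r}"]; auto)+
  have coord: "(\<epsilon> i - \<epsilon> j) \<bullet> \<epsilon> k = (if i = k then 1 else 0) - (if j = k then 1 else 0)"
    "(\<epsilon> i + \<epsilon> j) \<bullet> \<epsilon> k = (if i = k then 1 else 0) + (if j = k then 1 else 0)"
    if "1 \<le> i" "i \<le> j" "j \<le> r" "k \<in> {1..r}" for i j k
    using that by (auto simp: inner_diff_left inner_add_left)
  have injA: "inj_on ?f ?A"
  proof (rule inj_onI, clarify)
    fix i j i' j' assume *: "1 \<le> i" "i < j" "j \<le> r" "1 \<le> i'" "i' < j'" "j' \<le> r"
      and eq: "\<epsilon> i - \<epsilon> j = \<epsilon> i' - \<epsilon> j'"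
    have "(if i = k then 1 else 0) - (if j = k then 1 else 0)
        = (if i' = k then 1 else 0) - (if j' = k then 1 else 0 :: real)" if "k \<in> {1..r}" for k
      using coord(1)[of i j k] coord(1)[of i' j' k] * that unfolding eq by simp
    from this[of i] this[of j] show "i = i' \<and> j = j'"
      using * by (simp split: if_splits)
  qed
  have injB: "inj_on ?g ?B"
  proof (rule inj_onI, clarify)
    fix i j i' j' assume *: "1 \<le> i" "i \<le> j" "j \<le> r" "1 \<le> i'" "i' \<le> j'" "j' \<le> r"
      and eq: "\<epsilon> i + \<epsilon> j = \<epsilon> i' + \<epsilon> j'"
    have "(if i = k then 1 else 0) + (if j = k then 1 else 0)
        = (if i' = k then 1 else 0) + (if j' = k then 1 else 0 :: real)" if "k \<in> {1..r}" for k
      using coord(2)[of i j k] coord(2)[of i' j' k] * that unfolding eq by simp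
    from this[of i] this[of j] show "i = i' \<and> j = j'"
      using * by (simp split: if_splits)
  qed
  have disj: "?f ` ?A \<inter> ?g ` ?B = {}"
  proof -
    have False if *: "1 \<le> i" "i < j" "j \<le> r" "1 \<le> i'" "i' \<le> j'" "j' \<le> r"
      and eq: "\<epsilon> i - \<epsilon> j = \<epsilon> i' + \<epsilon> j'" for i j i' j'
      using coord(1)[of i j j] coord(2)[of i' j' j] * unfolding eq by (simp split: if_splits)
    then show ?thesis by fastforce
  qed
  have B: "?B = ?A \<union> ?D" "?A \<inter> ?D = {}" by auto
  have "(\<Sum>\<alpha>\<in>positive_roots r \<epsilon>. \<alpha>) = (\<Sum>p\<in>?A. ?f p) + (\<Sum>p\<in>?B. ?g p)"
    unfolding positive_roots_eq
      sum.union_disjoint[OF finite_imageI[OF finA] finite_imageI[OF finB] disj]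
      sum.reindex[OF injA] sum.reindex[OF injB] comp_def id_def ..
  also have "(\<Sum>p\<in>?B. ?g p) = (\<Sum>p\<in>?A. ?g p) + (\<Sum>p\<in>?D. ?g p)"
    unfolding B(1) using finA B(2) by (intro sum.union_disjoint) auto
  also have "(\<Sum>p\<in>?D. ?g p) = (\<Sum>p\<in>?D. 2 *\<^sub>R \<epsilon> (fst p))"
    by (intro sum.cong) (auto simp: scaleR_2)
  also have "(\<Sum>p\<in>?A. ?f p) + ((\<Sum>p\<in>?A. ?g p) + (\<Sum>p\<in>?D. 2 *\<^sub>R \<epsilon> (fst p)))
      = (\<Sum>p\<in>?A. 2 *\<^sub>R \<epsilon> (fst p)) + (\<Sum>p\<in>?D. 2 *\<^sub>R \<epsilon> (fst p))"
    by (simp add: sum.distrib[symmetric] add.assoc[symmetric] case_prod_beta scaleR_2)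
  also have "\<dots> = (\<Sum>p\<in>?B. 2 *\<^sub>R \<epsilon> (fst p))"
    unfolding B(1) using finA B(2) by (intro sum.union_disjoint[symmetric]) auto
  also have "?B = Sigma {1..r} (\<lambda>i. {i..r})" by auto
  also have "(\<Sum>p\<in>Sigma {1..r} (\<lambda>i. {i..r}). 2 *\<^sub>R \<epsilon> (fst p))
      = (\<Sum>i = 1..r. \<Sum>j = i..r. 2 *\<^sub>R \<epsilon> i)"
    by (simp add: sum.Sigma case_prod_beta)
  finally show ?thesis
    by (simp add: weyl_vector_def scaleR_sum_right sum_constant_scaleR add_divide_distrib diff_divide_distrib)
qed

lemma weyl_vector_coord:
  assumes "i \<in> {1..r}" shows "weyl_vector r \<epsilon> \<bullet> \<epsilon> i = real (r + 1 - i)"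
proof -
  have "weyl_vector r \<epsilon> \<bullet> \<epsilon> i = (\<Sum>j = 1..r. if j = i then real (r + 1 - j) else 0)"
    unfolding weyl_vector_eq inner_sum_left using assms by (intro sum.cong) auto
  then show ?thesis using assms by simp
qed

definition shifted :: 'a where
  "shifted = (\<Sum>i = 1..r. simple_root r \<epsilon> i) + weyl_vector r \<epsilon>"

lemma sum_simple_roots: "(\<Sum>i = 1..r. simple_root r \<epsilon> i) = \<epsilon> 1 + \<epsilon> r"
proof (rule psum_eqI)
  fix m assume m: "m \<in> {1..r}"
  then have "psum m (\<Sum>i = 1..r. simple_root r \<epsilon> i)
      = (\<Sum>i = 1..r. if m = i then if i = r then 2 else 1 else 0)"
    by (simp add: psum_simple_root)
  then show "psum m (\<Sum>i = 1..r. simple_root r \<epsilon> i) = psum m (\<epsilon> 1 + \<epsilon> r)"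
    using m by (simp add: psum_basis)
qed

lemma shifted_coord:
  assumes "i \<in> {1..r}"
  shows "shifted \<bullet> \<epsilon> i = (if i = 1 then r + 1 else if i = r then 2 else r + 1 - i)"
  unfolding shifted_def sum_simple_roots using assms r3
  by (auto simp: inner_add_left weyl_vector_coord)

lemma psum_shifted:
  assumes "m \<in> {1..r}"
  shows "psum m shifted = psum m (weyl_vector r \<epsilon>) + (if m = r then 2 else 1)"
  unfolding shifted_def sum_simple_roots using assms r3 by (simp add: psum_basis)

section \<open>Positivity of the partition function\<close>

text \<open>
  The inner product with \<open>\<rho>\<close> is a height function; it bounds the multiplicities in any partition.
\<close>

lemma weyl_vector_inner_positive_root:
  assumes "\<alpha> \<in> positive_roots r \<epsilon>" shows "1 \<le> weyl_vector r \<epsilon> \<bullet> \<alpha>"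
  using assms unfolding positive_roots_def
  by (auto simp: inner_diff_right inner_add_right weyl_vector_coord)

lemma psum_positive_root:
  assumes "\<alpha> \<in> positive_roots r \<epsilon>" "m \<le> r" shows "0 \<le> psum m \<alpha>"
  using assms unfolding positive_roots_def by (auto simp: psum_basis)

lemma finite_partitions:
  "finite {c \<in> positive_roots r \<epsilon> \<rightarrow>\<^sub>E (UNIV :: nat set).
     (\<Sum>\<alpha>\<in>positive_roots r \<epsilon>. real (c \<alpha>) *\<^sub>R \<alpha>) = \<xi>}" (is "finite ?C")
proof (rule finite_subset)
  let ?R = "positive_roots r \<epsilon>" and ?\<rho> = "weyl_vector r \<epsilon>"
  show "?C \<subseteq> ?R \<rightarrow>\<^sub>E {..nat \<lfloor>?\<rho> \<bullet> \<xi>\<rfloor>}"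
  proof (clarsimp simp: PiE_iff)
    fix c \<alpha> assume \<alpha>: "\<alpha> \<in> ?R"
    have "real (c \<alpha>) \<le> real (c \<alpha>) * (?\<rho> \<bullet> \<alpha>)"
      using weyl_vector_inner_positive_root[OF \<alpha>] by (simp add: mult_le_cancel_left1)
    also have "\<dots> \<le> (\<Sum>\<alpha>\<in>?R. real (c \<alpha>) * (?\<rho> \<bullet> \<alpha>))"
      using weyl_vector_inner_positive_root finite_positive_roots \<alpha>
      by (intro member_le_sum) (auto intro!: mult_nonneg_nonneg intro: order_trans[of 0 1])
    also have "\<dots> = ?\<rho> \<bullet> (\<Sum>\<alpha>\<in>?R. real (c \<alpha>) *\<^sub>R \<alpha>)" by (simp add: inner_sum_right)
    finally show "c \<alpha> \<le> nat \<lfloor>?\<rho> \<bullet> (\<Sum>\<alpha>\<in>?R. real (c \<alpha>) *\<^sub>R \<alpha>)\<rfloor>" by linarith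
  qed
  show "finite (?R \<rightarrow>\<^sub>E {..nat \<lfloor>?\<rho> \<bullet> \<xi>\<rfloor>})"
    using finite_positive_roots by (intro finite_PiE) auto
qed

lemma simple_root_positive: "i \<in> {1..r} \<Longrightarrow> simple_root r \<epsilon> i \<in> positive_roots r \<epsilon>"
proof (cases "i < r")
  case True
  then show "i \<in> {1..r} \<Longrightarrow> ?thesis"
    unfolding positive_roots_def simple_root_def
    by (intro UnI1, simp) (intro exI[of _ i] exI[of _ "Suc i"], auto)
next
  case False
  then show "i \<in> {1..r} \<Longrightarrow> ?thesis"
    unfolding positive_roots_def simple_root_def by auto
qed

lemma partition_function_pos_imp_psum_nonneg:
  assumes "partition_function r \<epsilon> \<xi> > 0" "m \<le> r"
  shows "0 \<le> psum m \<xi>"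
proof -
  from assms(1) obtain c :: "'a \<Rightarrow> nat"
    where "\<xi> = (\<Sum>\<alpha>\<in>positive_roots r \<epsilon>. real (c \<alpha>) *\<^sub>R \<alpha>)"
    unfolding partition_function_def by (auto simp: card_gt_0_iff)
  then show ?thesis
    using psum_positive_root[OF _ assms(2)] by (simp add: sum_nonneg)
qed

text \<open>
  A combination of simple roots is a partition in which all other positive roots
  have multiplicity 0.
\<close>

lemma partition_function_posI:
  fixes n :: "nat \<Rightarrow> nat"
  assumes "\<xi> = (\<Sum>i = 1..r. real (n i) *\<^sub>R simple_root r \<epsilon> i)"
  shows "partition_function r \<epsilon> \<xi> > 0"
proof -
  let ?R = "positive_roots r \<epsilon>" and ?s = "simple_root r \<epsilon>"
  \<comment> \<open>Each root collects the multiplicities of its fibre, so the sum over roots regroups the sum over indices.\<close>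
  define c where "c = (\<lambda>\<alpha>\<in>?R. \<Sum>i | i \<in> {1..r} \<and> ?s i = \<alpha>. n i)"
  have "(\<Sum>\<alpha>\<in>?R. real (c \<alpha>) *\<^sub>R \<alpha>)
      = (\<Sum>\<alpha>\<in>?R. \<Sum>i | i \<in> {1..r} \<and> ?s i = \<alpha>. real (n i) *\<^sub>R ?s i)"
  proof (rule sum.cong[OF refl])
    fix \<alpha> assume "\<alpha> \<in> ?R"
    then have "real (c \<alpha>) *\<^sub>R \<alpha> = (\<Sum>i | i \<in> {1..r} \<and> ?s i = \<alpha>. real (n i) *\<^sub>R \<alpha>)"
      by (simp add: c_def scaleR_sum_left)
    also have "\<dots> = (\<Sum>i | i \<in> {1..r} \<and> ?s i = \<alpha>. real (n i) *\<^sub>R ?s i)"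
      by (rule sum.cong) auto
    finally show "real (c \<alpha>) *\<^sub>R \<alpha> = (\<Sum>i | i \<in> {1..r} \<and> ?s i = \<alpha>. real (n i) *\<^sub>R ?s i)" .
  qed
  also have "\<dots> = \<xi>"
    unfolding assms
    by (rule sum.group) (use finite_positive_roots simple_root_positive in blast)+
  finally have "(\<Sum>\<alpha>\<in>?R. real (c \<alpha>) *\<^sub>R \<alpha>) = \<xi>" .
  moreover have "c \<in> ?R \<rightarrow>\<^sub>E (UNIV :: nat set)" unfolding c_def by simp
  ultimately have "c \<in> {c \<in> ?R \<rightarrow>\<^sub>E (UNIV :: nat set). (\<Sum>\<alpha>\<in>?R. real (c \<alpha>) *\<^sub>R \<alpha>) = \<xi>}"
    by blast
  then show ?thesis
    unfolding partition_function_def using finite_partitions by (auto simp: card_gt_0_iff)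
qed


section \<open>Weyl group elements as signed permutations\<close>

text \<open>
  The permutation acts contravariantly: \<open>q\<close> says from which position the entry at \<open>i\<close> is taken,
  so composition of maps reverses the order of the permutations.
\<close>

definition signed_perm :: "('a \<Rightarrow> 'a) \<Rightarrow> (nat \<Rightarrow> nat) \<Rightarrow> (nat \<Rightarrow> real) \<Rightarrow> bool" where
  "signed_perm \<sigma> q g \<longleftrightarrow> q permutes {1..r} \<and> (\<forall>i. g i = 1 \<or> g i = - 1)
     \<and> (\<forall>y. \<forall>i\<in>{1..r}. \<sigma> y \<bullet> \<epsilon> i = g i * (y \<bullet> \<epsilon> (q i)))"

abbreviation perm_action :: "('a \<Rightarrow> 'a) \<Rightarrow> (nat \<Rightarrow> nat) \<Rightarrow> bool" where
  "perm_action \<sigma> q \<equiv> signed_perm \<sigma> q (\<lambda>_. 1)"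

abbreviation swap :: "nat \<Rightarrow> nat \<Rightarrow> nat" where
  "swap a \<equiv> Transposition.transpose a (Suc a)"

abbreviation s :: "nat \<Rightarrow> 'a \<Rightarrow> 'a" where
  "s \<equiv> simple_reflection r \<epsilon>"

lemma signed_perm_coord:
  "signed_perm \<sigma> q g \<Longrightarrow> i \<in> {1..r} \<Longrightarrow> \<sigma> y \<bullet> \<epsilon> i = g i * (y \<bullet> \<epsilon> (q i))"
  by (simp add: signed_perm_def)

lemma signed_perm_in_range: "signed_perm \<sigma> q g \<Longrightarrow> i \<in> {1..r} \<Longrightarrow> q i \<in> {1..r}"
  unfolding signed_perm_def using permutes_in_image by metis

lemma signed_perm_inj: "signed_perm \<sigma> q g \<Longrightarrow> q i = q j \<longleftrightarrow> i = j"
  unfolding signed_perm_def using permutes_inj by (metis injD)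

lemma signed_perm_id: "perm_action id id"
  by (simp add: signed_perm_def permutes_id)

lemma signed_perm_comp:
  assumes "signed_perm \<sigma> q g" "signed_perm \<tau> p h"
  shows "signed_perm (\<sigma> \<circ> \<tau>) (p \<circ> q) (\<lambda>i. g i * h (q i))"
  unfolding signed_perm_def
proof (intro conjI allI ballI)
  show "(p \<circ> q) permutes {1..r}"
    using assms unfolding signed_perm_def by (blast intro: permutes_compose)
  show "g i * h (q i) = 1 \<or> g i * h (q i) = - 1" for i
  proof -
    have "g i = 1 \<or> g i = - 1" "h (q i) = 1 \<or> h (q i) = - 1"
      using assms unfolding signed_perm_def by blast+
    then show ?thesis by auto
  qed
  fix y i assume i: "i \<in> {1..r}"
  show "(\<sigma> \<circ> \<tau>) y \<bullet> \<epsilon> i = g i * h (q i) * (y \<bullet> \<epsilon> ((p \<circ> q) i))"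
    using signed_perm_coord[OF assms(1) i, of "\<tau> y"]
      signed_perm_coord[OF assms(2) signed_perm_in_range[OF assms(1) i], of y]
    by simp
qed

lemma perm_action_comp:
  "perm_action \<sigma> q \<Longrightarrow> perm_action \<tau> p \<Longrightarrow> perm_action (\<sigma> \<circ> \<tau>) (p \<circ> q)"
  using signed_perm_comp[of \<sigma> q "\<lambda>_. 1" \<tau> p "\<lambda>_. 1"] by simp

lemma perm_action_unique:
  assumes "perm_action \<sigma> q" "perm_action \<tau> p" "\<And>i. i \<in> {1..r} \<Longrightarrow> q i = p i"
  shows "\<sigma> = \<tau>"
proof
  fix y show "\<sigma> y = \<tau> y"
    using assms by (intro coord_eqI) (simp add: signed_perm_coord del: atLeastAtMost_iff)
qed

lemma reflection_formula:
  assumes "1 \<le> a" "a < r"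
  shows "s a y = y - (y \<bullet> \<epsilon> a - y \<bullet> \<epsilon> (Suc a)) *\<^sub>R simple_root r \<epsilon> a"
  using assms
  by (simp add: simple_reflection_def hyperplane_reflection_def simple_root_def
      inner_diff_left inner_diff_right)

lemma perm_action_reflection:
  assumes "1 \<le> a" "a < r"
  shows "perm_action (s a) (swap a)"
  unfolding signed_perm_def
proof (intro conjI allI ballI)
  show "swap a permutes {1..r}" using assms by (intro permutes_swap_id) auto
  fix y i assume i: "i \<in> {1..r}"
  show "s a y \<bullet> \<epsilon> i = 1 * (y \<bullet> \<epsilon> (swap a i))"
    using assms i unfolding reflection_formula[OF assms] simple_root_def
    by (cases "i = a"; cases "i = Suc a") (simp_all add: inner_diff_left)
qed simp

lemma signed_perm_last_reflection:
  "signed_perm (s r) id (\<lambda>i. if i = r then - 1 else 1)"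
proof -
  have "s r y \<bullet> \<epsilon> i = (if i = r then - 1 else 1) * (y \<bullet> \<epsilon> i)" if "i \<in> {1..r}" for y i
    using that r3
    by (simp add: simple_reflection_def hyperplane_reflection_def simple_root_def inner_diff_left)
  then show ?thesis by (simp add: signed_perm_def permutes_id)
qed

lemma signed_perm_simple_reflection:
  assumes "a \<in> {1..r}" shows "\<exists>q g. signed_perm (s a) q g"
  using assms perm_action_reflection[of a] signed_perm_last_reflection by (cases "a = r") auto

lemma reflection_involution: "s a (s a y) = y"
proof (cases "simple_root r \<epsilon> a = 0")
  case False
  let ?\<alpha> = "simple_root r \<epsilon> a"
  have "?\<alpha> \<bullet> ?\<alpha> \<noteq> 0" using False by simp
  then show ?thesis
    by (simp add: simple_reflection_def hyperplane_reflection_def inner_diff_left field_simps)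
qed (simp add: simple_reflection_def hyperplane_reflection_def)

lemma BijGroup_one: "\<one>\<^bsub>BijGroup UNIV\<^esub> = (id :: 'a \<Rightarrow> 'a)"
  by (simp add: BijGroup_def fun_eq_iff)

lemma reflection_Bij: "s a \<in> Bij UNIV"
  by (auto simp: Bij_def intro: bij_betw_byWitness[where f' = "s a"] reflection_involution)

text \<open>
  The simple reflections are involutions, so the inverses of generators are again generators.
  Bijectivity is carried along because \<^term>\<open>BijGroup UNIV\<close> multiplies as
  composition only on bijections.
\<close>

lemma weyl_group_signed_perm:
  assumes "\<sigma> \<in> weyl_group r \<epsilon>"
  shows "\<sigma> \<in> Bij UNIV \<and> (\<exists>q g. signed_perm \<sigma> q g)"
  using assms unfolding weyl_group_def
proof (induction rule: generate.induct)
  case one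
  have "(id :: 'a \<Rightarrow> 'a) \<in> Bij UNIV" unfolding Bij_def by (simp add: bij_betw_id)
  then show ?case unfolding BijGroup_one using signed_perm_id by blast
next
  case (incl h)
  then obtain a where a: "h = s a" "a \<in> {1..r}" by auto
  then show ?case using signed_perm_simple_reflection[OF a(2)] reflection_Bij a(1) by simp
next
  case (inv h)
  then obtain a where a: "h = s a" "a \<in> {1..r}" by auto
  have "inv\<^bsub>BijGroup UNIV\<^esub> (s a) = s a"
  proof
    fix y
    show "(inv\<^bsub>BijGroup UNIV\<^esub> (s a)) y = s a y"
      using reflection_Bij[of a]
      by (simp add: inv_BijGroup inv_f_eq reflection_involution inj_on_inverseI[of _ "s a"])
  qed
  then show ?case using signed_perm_simple_reflection[OF a(2)] reflection_Bij a(1) by simp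
next
  case (eng h1 h2)
  then have "h1 \<otimes>\<^bsub>BijGroup UNIV\<^esub> h2 = h1 \<circ> h2"
    by (auto simp: BijGroup_def compose_def fun_eq_iff)
  moreover have "h1 \<circ> h2 \<in> Bij UNIV"
    using eng.IH by (auto simp: Bij_def intro: bij_comp)
  ultimately show ?case using eng.IH signed_perm_comp by metis
qed

lemma weyl_group_id: "id \<in> weyl_group r \<epsilon>"
  unfolding weyl_group_def BijGroup_one[symmetric] by (rule generate.one)

lemma weyl_group_comp:
  assumes "\<sigma> \<in> weyl_group r \<epsilon>" "\<tau> \<in> weyl_group r \<epsilon>"
  shows "\<sigma> \<circ> \<tau> \<in> weyl_group r \<epsilon>"
proof -
  have "\<sigma> \<otimes>\<^bsub>BijGroup UNIV\<^esub> \<tau> = \<sigma> \<circ> \<tau>"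
    using assms[THEN weyl_group_signed_perm]
    by (auto simp: BijGroup_def compose_def fun_eq_iff)
  then show ?thesis using assms generate.eng unfolding weyl_group_def by metis
qed

lemma weyl_group_reflection: "a \<in> {1..r} \<Longrightarrow> s a \<in> weyl_group r \<epsilon>"
  unfolding weyl_group_def by (intro generate.incl) simp

lemma refl_word_simps [simp]:
  "refl_word r \<epsilon> [] = id" "refl_word r \<epsilon> (a # w) = s a \<circ> refl_word r \<epsilon> w"
  by (simp_all add: refl_word_def)

lemma weyl_group_word:
  "set w \<subseteq> {1..r} \<Longrightarrow> refl_word r \<epsilon> w \<in> weyl_group r \<epsilon>"
proof (induction w)
  case (Cons a w)
  then have "s a \<in> weyl_group r \<epsilon>" "refl_word r \<epsilon> w \<in> weyl_group r \<epsilon>"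
    using weyl_group_reflection[of a] by simp_all
  then show ?case unfolding refl_word_simps by (rule weyl_group_comp)
qed (simp add: weyl_group_id)

lemma perm_action_word:
  "set w \<subseteq> {1..<r} \<Longrightarrow> \<exists>q. perm_action (refl_word r \<epsilon> w) q"
proof (induction w)
  case Nil
  then show ?case unfolding refl_word_simps using signed_perm_id by blast
next
  case (Cons a w)
  then obtain q where "perm_action (refl_word r \<epsilon> w) q" by auto
  moreover have "perm_action (s a) (swap a)" using Cons.prems perm_action_reflection by simp
  ultimately show ?case unfolding refl_word_simps using perm_action_comp by blast
qed


section \<open>The dominance condition\<close>

text \<open>
  This is the condition that \<open>\<sigma>(\<lambda> + \<rho>) - \<rho>\<close> has nonnegative coefficients in the simple roots.
\<close>

definition dominates :: "('a \<Rightarrow> 'a) \<Rightarrow> bool" where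
  "dominates \<sigma> \<longleftrightarrow> (\<forall>m\<in>{1..r}. psum m (weyl_vector r \<epsilon>) \<le> psum m (\<sigma> shifted))"

lemma shifted_coord_ge: "i \<in> {1..r} \<Longrightarrow> 2 \<le> shifted \<bullet> \<epsilon> i"
  using r3 by (auto simp: shifted_coord)

lemma psum_perm_action:
  assumes "perm_action \<sigma> q" shows "psum r (\<sigma> y) = psum r y"
proof -
  have "psum r (\<sigma> y) = (\<Sum>i = 1..r. y \<bullet> \<epsilon> (q i))"
    unfolding psum_def using signed_perm_coord[OF assms] by (intro sum.cong) simp_all
  also have "\<dots> = psum r y"
    unfolding psum_def using sum.permute[of q "{1..r}" "\<lambda>i. y \<bullet> \<epsilon> i"] assms
    by (simp add: signed_perm_def comp_def)
  finally show ?thesis .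
qed

text \<open>
  A negative sign lowers the total by twice an entry of \<open>\<lambda> + \<rho>\<close>, hence by at least 4, while
  the total of \<open>\<lambda> + \<rho>\<close> exceeds the total of \<open>\<rho>\<close> by 2 only.
\<close>

lemma dominates_imp_perm_action:
  assumes "signed_perm \<sigma> q g" "dominates \<sigma>"
  shows "perm_action \<sigma> q"
proof -
  let ?x = "\<lambda>i. shifted \<bullet> \<epsilon> i"
  have q: "q permutes {1..r}" using assms(1) by (simp add: signed_perm_def)
  have g: "g i = 1 \<or> g i = - 1" for i using assms(1) unfolding signed_perm_def by blast
  have "g i = 1" if i: "i \<in> {1..r}" for i
  proof (rule ccontr)
    assume "g i \<noteq> 1"
    then have "g i = - 1" using g[of i] by simp
    then have "4 \<le> ?x (q i) - g i * ?x (q i)"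
      using shifted_coord_ge[OF signed_perm_in_range[OF assms(1) i]] by simp
    also have "\<dots> \<le> (\<Sum>j = 1..r. ?x (q j) - g j * ?x (q j))"
    proof (rule member_le_sum)
      fix j assume j: "j \<in> {1..r} - {i}"
      then have "0 \<le> ?x (q j)"
        using shifted_coord_ge[OF signed_perm_in_range[OF assms(1), of j]] by simp
      then show "0 \<le> ?x (q j) - g j * ?x (q j)" using g[of j] by auto
    qed (use i in auto)
    also have "\<dots> = (\<Sum>j = 1..r. ?x (q j)) - psum r (\<sigma> shifted)"
      unfolding sum_subtractf psum_def using signed_perm_coord[OF assms(1)]
      by (intro arg_cong2[where f = "(-)"] refl sum.cong) simp_all
    also have "(\<Sum>j = 1..r. ?x (q j)) = psum r shifted"
      unfolding psum_def using sum.permute[OF q, of ?x] by (simp add: comp_def)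
    also have "\<dots> = psum r (weyl_vector r \<epsilon>) + 2" using r3 by (simp add: psum_shifted)
    finally have "psum r (\<sigma> shifted) < psum r (weyl_vector r \<epsilon>)" by simp
    moreover have "r \<in> {1..r}" using r3 by simp
    ultimately show False using assms(2) unfolding dominates_def by force
  qed
  then show ?thesis using assms(1) unfolding signed_perm_def by simp
qed

lemma psum_Ints:
  assumes "m \<le> r" "perm_action \<sigma> q"
  shows "psum m (\<sigma> shifted - weyl_vector r \<epsilon>) \<in> \<int>"
  unfolding psum_def
proof (rule Ints_sum)
  fix i assume "i \<in> {1..m}"
  then have i: "i \<in> {1..r}" using assms by auto
  then show "(\<sigma> shifted - weyl_vector r \<epsilon>) \<bullet> \<epsilon> i \<in> \<int>"
    unfolding inner_diff_left signed_perm_coord[OF assms(2) i] weyl_vector_coord[OF i]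
      shifted_coord[OF signed_perm_in_range[OF assms(2) i]]
    by (simp add: Ints_diff del: of_nat_Suc of_nat_add of_nat_diff)
qed

text \<open>
  A permutation keeps the total, so the coefficient of the last simple root in
  \<open>\<sigma>(\<lambda> + \<rho>) - \<rho>\<close> is \<open>2 / 2 = 1\<close>; the other coefficients are the partial sums, which are integers.
\<close>

lemma partition_function_pos_iff:
  assumes "perm_action \<sigma> q"
  shows "partition_function r \<epsilon> (\<sigma> shifted - weyl_vector r \<epsilon>) > 0 \<longleftrightarrow> dominates \<sigma>"
proof
  assume "partition_function r \<epsilon> (\<sigma> shifted - weyl_vector r \<epsilon>) > 0"
  from partition_function_pos_imp_psum_nonneg[OF this]
  show "dominates \<sigma>" unfolding dominates_def by simp
next
  assume dom: "dominates \<sigma>"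
  let ?\<xi> = "\<sigma> shifted - weyl_vector r \<epsilon>"
  have top: "psum r ?\<xi> = 2"
    using psum_perm_action[OF assms, of shifted] psum_shifted[of r] r3 by simp
  define n where "n i = (if i = r then 1 else nat \<lfloor>psum i ?\<xi>\<rfloor>)" for i
  have n: "real (n i) * (if i = r then 2 else 1) = psum i ?\<xi>" if i: "i \<in> {1..r}" for i
  proof (cases "i = r")
    case False
    have "psum i ?\<xi> \<in> \<int>" using psum_Ints[OF _ assms] i by simp
    moreover have "0 \<le> psum i ?\<xi>" using dom i unfolding dominates_def by simp
    ultimately show ?thesis using False by (auto simp: n_def elim!: Ints_cases)
  qed (use top in \<open>simp add: n_def\<close>)
  have "?\<xi> = (\<Sum>i = 1..r. real (n i) *\<^sub>R simple_root r \<epsilon> i)"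
  proof (rule psum_eqI)
    fix m assume m: "m \<in> {1..r}"
    have "psum m (\<Sum>i = 1..r. real (n i) *\<^sub>R simple_root r \<epsilon> i)
        = (\<Sum>i = 1..r. if m = i then psum i ?\<xi> else 0)"
      unfolding psum_linear(3,4)
    proof (rule sum.cong[OF refl])
      fix i assume i: "i \<in> {1..r}"
      show "real (n i) * psum m (simple_root r \<epsilon> i) = (if m = i then psum i ?\<xi> else 0)"
        using n[OF i] psum_simple_root[OF i, of m] m by auto
    qed
    then show "psum m ?\<xi> = psum m (\<Sum>i = 1..r. real (n i) *\<^sub>R simple_root r \<epsilon> i)"
      using m by simp
  qed
  then show "partition_function r \<epsilon> ?\<xi> > 0" by (rule partition_function_posI)
qed

text \<open>
  A simple reflection changes a single coefficient with respect to the simple roots.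
\<close>

lemma psum_reflection:
  assumes "1 \<le> a" "a < r" "m \<le> r"
  shows "psum m (s a y) = psum m y + (if m = a then y \<bullet> \<epsilon> (Suc a) - y \<bullet> \<epsilon> a else 0)"
  using assms by (simp add: reflection_formula psum_simple_root)

lemma psum_perm_action_fix:
  assumes "perm_action \<sigma> q" "\<And>i. i \<in> {1..m} \<Longrightarrow> q i = i" "m \<le> r"
  shows "psum m (\<sigma> y) = psum m y"
  unfolding psum_def using assms signed_perm_coord[OF assms(1)] by (intro sum.cong) simp_all


section \<open>From dominance to words\<close>

lemma nonconsecutive_Nil [simp]: "nonconsecutive []"
  by (simp add: nonconsecutive_def)

lemma nonconsecutive_Cons:
  "nonconsecutive (a # w) \<longleftrightarrow> nonconsecutive w \<and> (\<forall>b\<in>set w. 2 \<le> \<bar>int a - int b\<bar>)"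
  (is "?L \<longleftrightarrow> ?R")
proof
  assume L: ?L
  have "nonconsecutive w"
    unfolding nonconsecutive_def
  proof (intro allI impI)
    fix i j assume "i < length w" "j < length w" "i \<noteq> j"
    then show "2 \<le> \<bar>int (w ! i) - int (w ! j)\<bar>"
      using L[unfolded nonconsecutive_def, rule_format, of "Suc i" "Suc j"] by simp
  qed
  moreover have "2 \<le> \<bar>int a - int b\<bar>" if b: "b \<in> set w" for b
  proof -
    obtain j where "j < length w" "w ! j = b" using b by (auto simp: in_set_conv_nth)
    then show ?thesis
      using L[unfolded nonconsecutive_def, rule_format, of 0 "Suc j"] by simp
  qed
  ultimately show ?R by blast
next
  assume R: ?R
  show ?L
    unfolding nonconsecutive_def
  proof (intro allI impI)
    fix i j assume *: "i < length (a # w)" "j < length (a # w)" "i \<noteq> j"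
    consider i' j' where "i = Suc i'" "j = Suc j'" | j' where "i = 0" "j = Suc j'"
      | i' where "i = Suc i'" "j = 0"
      using *(3) by (cases i; cases j) auto
    then show "2 \<le> \<bar>int ((a # w) ! i) - int ((a # w) ! j)\<bar>"
    proof cases
      case 1
      then show ?thesis using R * by (simp add: nonconsecutive_def)
    next
      case 2
      then show ?thesis using R * by simp
    next
      case 3
      then have "w ! i' \<in> set w" using * by simp
      then have "2 \<le> \<bar>int a - int (w ! i')\<bar>" using R by blast
      then show ?thesis by (simp add: 3 abs_minus_commute[of "int (w ! i')"])
    qed
  qed
qed

text \<open>
  The asserted normal forms, with all indices at least \<open>k\<close>; the identity is the empty word.
  The theorem is about \<open>k = 2\<close>, the other values occur in the induction.  The second family
  requires \<open>k + 2 \<le> r\<close>, since its last factor involves \<open>s\<^sub>r\<^sub>-\<^sub>2\<close>.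
\<close>

definition listed :: "nat \<Rightarrow> ('a \<Rightarrow> 'a) \<Rightarrow> bool" where
  "listed k \<sigma> \<longleftrightarrow>
     (\<exists>w. set w \<subseteq> {k..r - 1} \<and> nonconsecutive w \<and> \<sigma> = refl_word r \<epsilon> w) \<or>
     (k + 2 \<le> r \<and>
      (\<exists>w \<pi>. set w \<subseteq> {k..r - 4} \<and> nonconsecutive w \<and>
         \<pi> \<in> {s (r - 2) \<circ> s (r - 1), s (r - 1) \<circ> s (r - 2),
              s (r - 2) \<circ> s (r - 1) \<circ> s (r - 2)} \<and>
         \<sigma> = refl_word r \<epsilon> w \<circ> \<pi>))"

lemma listed_mono: assumes "listed (Suc k) \<sigma>" shows "listed k \<sigma>"
proof -
  have sub: "A \<subseteq> {k..n}" if "A \<subseteq> {Suc k..n}" for A n using that by fastforce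
  have "k + 2 \<le> r" if "Suc k + 2 \<le> r" using that by simp
  with assms sub show ?thesis unfolding listed_def by blast
qed

lemma listed_swap:
  assumes "listed (k + 2) \<sigma>" "k < r" shows "listed k (s k \<circ> \<sigma>)"
proof -
  have nc: "nonconsecutive (k # w)" if "nonconsecutive w" "set w \<subseteq> {k + 2..n}" for w n
    unfolding nonconsecutive_Cons using that by fastforce
  from assms(1)[unfolded listed_def] show ?thesis
  proof (elim disjE conjE exE)
    fix w assume w: "set w \<subseteq> {k + 2..r - 1}" "nonconsecutive w" "\<sigma> = refl_word r \<epsilon> w"
    have "set (k # w) \<subseteq> {k..r - 1}" using w(1) assms(2) by fastforce
    moreover have "nonconsecutive (k # w)" using nc w by blast
    moreover have "s k \<circ> \<sigma> = refl_word r \<epsilon> (k # w)" using w(3) by simp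
    ultimately show ?thesis unfolding listed_def by blast
  next
    fix w \<pi> assume w: "set w \<subseteq> {k + 2..r - 4}" "nonconsecutive w" "\<sigma> = refl_word r \<epsilon> w \<circ> \<pi>"
      and kr: "k + 2 + 2 \<le> r"
      and \<pi>: "\<pi> \<in> {s (r - 2) \<circ> s (r - 1), s (r - 1) \<circ> s (r - 2),
              s (r - 2) \<circ> s (r - 1) \<circ> s (r - 2)}"
    have "set (k # w) \<subseteq> {k..r - 4}" using w(1) kr by fastforce
    moreover have "nonconsecutive (k # w)" using nc w by blast
    moreover have "s k \<circ> \<sigma> = refl_word r \<epsilon> (k # w) \<circ> \<pi>" using w(3) by (simp add: comp_assoc)
    moreover have "k + 2 \<le> r" using kr by simp
    ultimately show ?thesis unfolding listed_def using \<pi> by blast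
  qed
qed

lemma reflection_comp_self: "s a \<circ> (s a \<circ> \<sigma>) = \<sigma>"
  by (simp add: fun_eq_iff reflection_involution)

text \<open>
  The left to right reading of \<open>\<sigma>(\<lambda> + \<rho>)\<close>, as an induction on the number of positions that are
  still to be read.  The positions below \<open>k\<close> are fixed, so the partial sum up to \<open>k - 1\<close> has
  surplus 1.  If \<open>k\<close> is fixed, go on with \<open>k + 1\<close>.  If \<open>\<sigma>\<close> exchanges \<open>k\<close> and \<open>k + 1\<close>, go on
  with \<open>s\<^sub>k \<sigma>\<close>, which fixes two more positions.  Anything else violates dominance unless \<open>k = r - 2\<close>.
\<close>

lemma dominates_imp_listed:
  assumes "2 \<le> k" "perm_action \<sigma> q" "\<And>i. i \<in> {1..<k} \<Longrightarrow> q i = i" "dominates \<sigma>"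
  shows "listed k \<sigma>"
  using assms
proof (induction "r + 1 - k" arbitrary: k \<sigma> q rule: less_induct)
  case less
  note k2 = less.prems(1) and act = less.prems(2) and fixd = less.prems(3) and dom = less.prems(4)
  let ?x = "\<lambda>i. shifted \<bullet> \<epsilon> i" and ?\<rho> = "weyl_vector r \<epsilon>"
  consider (all_fixed) "r < k" | (fixed) "k \<le> r" "q k = k" | (moved) "k \<le> r" "q k \<noteq> k"
    by linarith
  then show ?case
  proof cases
    case all_fixed
    have "\<sigma> = id"
      by (rule perm_action_unique[OF act signed_perm_id]) (use fixd all_fixed in auto)
    moreover have "set ([] :: nat list) \<subseteq> {k..r - 1}" "id = refl_word r \<epsilon> []" by simp_all
    ultimately show ?thesis unfolding listed_def using nonconsecutive_Nil by blast
  next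
    case fixed
    have "q i = i" if "i \<in> {1..<Suc k}" for i using that fixd fixed(2) by (cases "i = k") auto
    then have "listed (Suc k) \<sigma>" using less.hyps[of "Suc k" \<sigma> q] fixed(1) k2 act dom by simp
    then show ?thesis by (rule listed_mono)
  next
    case moved
    have q_upper: "q j \<in> {k..r}" if "k \<le> j" "j \<le> r" for j
    proof (rule ccontr)
      have "q j \<in> {1..r}" using signed_perm_in_range[OF act] that k2 by simp
      moreover assume "q j \<notin> {k..r}"
      ultimately have "q j \<in> {1..<k}" by simp
      then have "q (q j) = q j" by (rule fixd)
      then have "q j = j" using signed_perm_inj[OF act] by blast
      with \<open>q j \<in> {1..<k}\<close> that show False by simp
    qed
    have q_ne: "q i \<noteq> q j" if "i \<noteq> j" for i j using signed_perm_inj[OF act] that by blast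
    have kr: "k < r" using q_upper[of k] moved by (cases "k = r") auto
    obtain m where m: "k = Suc m" "1 \<le> m" using k2 by (cases k) auto
    have below: "psum m (\<sigma> shifted) = psum m ?\<rho> + 1"
      using psum_perm_action_fix[OF act, of m] psum_shifted[of m] fixd m kr by simp
    have x_val: "?x j = (if j = r then 2 else real r + 1 - real j)" if "j \<in> {k..r}" for j
      using that k2 shifted_coord[of j] by auto
    have at: "\<sigma> shifted \<bullet> \<epsilon> j = ?x (q j)" "?\<rho> \<bullet> \<epsilon> j = real r + 1 - real j"
      if "j \<in> {k..r}" for j
      using that k2 signed_perm_coord[OF act, of j] weyl_vector_coord[of j] by auto
    \<comment> \<open>Surplus 1 lets the entry at \<open>k\<close> fall short of the one in \<open>\<rho>\<close> by 1,
      and likewise for the sum of the entries at \<open>k\<close> and \<open>k + 1\<close>.\<close>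
    have dom_k: "real r - real k \<le> ?x (q k)"
      using dom[unfolded dominates_def, rule_format, of k] at[of k] kr below by (simp add: m)
    have dom_Suc: "2 * (real r - real k) \<le> ?x (q k) + ?x (q (Suc k))"
      using dom[unfolded dominates_def, rule_format, of "Suc k"] at[of k] at[of "Suc k"] kr below
      by (simp add: m)
    show ?thesis
    proof (cases "q k = Suc k \<and> q (Suc k) = k")
      case True
      let ?\<tau> = "s k \<circ> \<sigma>"
      have act': "perm_action ?\<tau> (q \<circ> swap k)"
        using perm_action_comp[OF perm_action_reflection act] k2 kr by simp
      have fixd': "(q \<circ> swap k) i = i" if "i \<in> {1..<k + 2}" for i
        using that True fixd[of i] by (cases "i = k"; cases "i = Suc k") auto
      have "dominates ?\<tau>"
        unfolding dominates_def
      proof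
        fix j assume j: "j \<in> {1..r}"
        show "psum j ?\<rho> \<le> psum j (?\<tau> shifted)"
        proof (cases "j = k")
          case False
          then show ?thesis
            using psum_reflection[of k j] k2 kr j dom[unfolded dominates_def, rule_format, OF j]
            by simp
        next
          case True
          have "psum k (?\<tau> shifted) = psum k shifted"
            by (rule psum_perm_action_fix[OF act']) (use fixd' kr in auto)
          then show ?thesis using True psum_shifted[OF j] by simp
        qed
      qed
      then have "listed (k + 2) ?\<tau>"
        using less.hyps[of "k + 2" ?\<tau> "q \<circ> swap k"] act' fixd' kr k2 by simp
      then have "listed k (s k \<circ> ?\<tau>)" using kr by (rule listed_swap)
      then show ?thesis unfolding reflection_comp_self .
    next
      case False
      have qk: "q k \<in> {k..r}" and qS: "q (Suc k) \<in> {k..r}"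
        using q_upper[of k] q_upper[of "Suc k"] kr by simp_all
      have qkS: "q k \<noteq> q (Suc k)" using q_ne[of k "Suc k"] by simp
      \<comment> \<open>Away from the repeated entry 2 the values are distinct, so the bounds
        would force the excluded swap.\<close>
      have r_eq: "r = k + 2"
      proof (cases "q k = Suc k")
        case True
        then have *: "q (Suc k) \<noteq> k" "q (Suc k) \<noteq> Suc k" using False qkS by auto
        then have "Suc k < r" using qS kr by (cases "Suc k = r") auto
        then show ?thesis
          using dom_Suc x_val[OF qk] x_val[OF qS] True * qS by (auto split: if_splits)
      next
        case False
        then show ?thesis using dom_k x_val[OF qk] moved(2) qk by (auto split: if_splits)
      qed
      have qT: "q (k + 2) \<in> {k..r}" using q_upper[of "k + 2"] r_eq by simp
      have qT': "q k \<noteq> q (k + 2)" "q (Suc k) \<noteq> q (k + 2)"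
        using q_ne[of k "k + 2"] q_ne[of "Suc k" "k + 2"] by simp_all
      have three: "j = k \<or> j = Suc k \<or> j = k + 2" if "j \<in> {k..r}" for j
        using that r_eq by auto
      have ak: "perm_action (s k) (swap k)"
        using k2 kr by (intro perm_action_reflection) auto
      have aS: "perm_action (s (Suc k)) (swap (Suc k))"
        using r_eq by (intro perm_action_reflection) auto
      have eqI: "\<sigma> = \<tau>" if "perm_action \<tau> p" "\<And>i. i < k \<Longrightarrow> p i = i"
        "q k = p k" "q (Suc k) = p (Suc k)" "q (k + 2) = p (k + 2)" for \<tau> p
      proof (rule perm_action_unique[OF act that(1)])
        fix i assume "i \<in> {1..r}"
        then show "q i = p i" using that three[of i] fixd[of i] by (cases "i < k") auto
      qed
      have swap_below: "swap k i = i" "swap (Suc k) i = i" if "i < k" for i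
        using that by (simp_all add: transpose_def)
      \<comment> \<open>Of the six permutations of three positions, the two fixing \<open>k\<close> and the
        swap of \<open>k\<close> and \<open>k + 1\<close> are already excluded.\<close>
      consider "q k = Suc k" "q (Suc k) = k + 2" "q (k + 2) = k"
        | "q k = k + 2" "q (Suc k) = k" "q (k + 2) = Suc k"
        | "q k = k + 2" "q (Suc k) = Suc k" "q (k + 2) = k"
        using three[OF qk] three[OF qS] three[OF qT] qkS qT' moved(2) False by auto
      then have "\<sigma> \<in> {s k \<circ> s (Suc k), s (Suc k) \<circ> s k, s k \<circ> s (Suc k) \<circ> s k}"
      proof cases
        case 1
        have "\<sigma> = s (Suc k) \<circ> s k"
          by (rule eqI[OF perm_action_comp[OF aS ak]])
            (use 1 swap_below in \<open>simp_all add: transpose_def\<close>)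
        then show ?thesis by simp
      next
        case 2
        have "\<sigma> = s k \<circ> s (Suc k)"
          by (rule eqI[OF perm_action_comp[OF ak aS]])
            (use 2 swap_below in \<open>simp_all add: transpose_def\<close>)
        then show ?thesis by simp
      next
        case 3
        have "\<sigma> = s k \<circ> s (Suc k) \<circ> s k"
          by (rule eqI[OF perm_action_comp[OF perm_action_comp[OF ak aS] ak]])
            (use 3 swap_below in \<open>simp_all add: transpose_def\<close>)
        then show ?thesis by simp
      qed
      moreover have "k = r - 2" "Suc k = r - 1" "k + 2 \<le> r" using r_eq by simp_all
      moreover have "\<sigma> = refl_word r \<epsilon> [] \<circ> \<sigma>" "set ([] :: nat list) \<subseteq> {k..r - 4}" by simp_all
      ultimately show ?thesis unfolding listed_def using nonconsecutive_Nil by metis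
    qed
  qed
qed

text \<open>
  The first entry of \<open>\<rho>\<close> is \<open>r\<close>, and only the first entry of \<open>\<lambda> + \<rho>\<close> is that large.
\<close>

lemma signed_perm_dominates_imp_listed:
  assumes "signed_perm \<sigma> q g" "dominates \<sigma>"
  shows "listed 2 \<sigma>"
proof -
  have act: "perm_action \<sigma> q" using assms by (rule dominates_imp_perm_action)
  have one: "1 \<in> {1..r}" using r3 by simp
  have q1: "q 1 \<in> {1..r}" using signed_perm_in_range[OF act one] .
  have "real r \<le> shifted \<bullet> \<epsilon> (q 1)"
    using assms(2)[unfolded dominates_def, rule_format, OF one]
      signed_perm_coord[OF act one, of shifted] weyl_vector_coord[OF one] by simp
  then have "q 1 = 1" using q1 r3 unfolding shifted_coord[OF q1] by (auto split: if_splits)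
  then have "q i = i" if "i \<in> {1..<2}" for i using that by (cases "i = 1") auto
  then show ?thesis using dominates_imp_listed[of 2 \<sigma> q] act assms(2) by blast
qed


section \<open>From words to dominance\<close>

lemma word_coord_far:
  assumes "set w \<subseteq> {1..<r}" "i \<in> {1..r}" "i \<notin> set w" "i \<notin> Suc ` set w"
  shows "refl_word r \<epsilon> w y \<bullet> \<epsilon> i = y \<bullet> \<epsilon> i"
  using assms
proof (induction w)
  case (Cons a w)
  have "s a (refl_word r \<epsilon> w y) \<bullet> \<epsilon> i = refl_word r \<epsilon> w y \<bullet> \<epsilon> i"
    using signed_perm_coord[OF perm_action_reflection, of a i] Cons.prems by (auto simp: transpose_def)
  with Cons show ?case by simp
qed simp

text \<open>
  Since no index of the word is adjacent to another one, each reflection meets the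
  coordinates that it exchanges in their original state.
\<close>

lemma psum_word:
  assumes "set w \<subseteq> {1..<r}" "nonconsecutive w" "m \<le> r"
  shows "psum m (refl_word r \<epsilon> w y)
    = psum m y + (if m \<in> set w then y \<bullet> \<epsilon> (Suc m) - y \<bullet> \<epsilon> m else 0)"
  using assms
proof (induction w)
  case (Cons a w)
  let ?z = "refl_word r \<epsilon> w y"
  have a: "1 \<le> a" "a < r" and w: "set w \<subseteq> {1..<r}" "nonconsecutive w"
    and far: "\<And>b. b \<in> set w \<Longrightarrow> 2 \<le> \<bar>int a - int b\<bar>"
    using Cons.prems by (auto simp: nonconsecutive_Cons)
  have "a \<notin> set w" "Suc a \<notin> set w" "a \<notin> Suc ` set w" "Suc a \<notin> Suc ` set w"
    using far[of a] far[of "Suc a"] far by (force simp: image_iff)+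
  then have "?z \<bullet> \<epsilon> a = y \<bullet> \<epsilon> a" "?z \<bullet> \<epsilon> (Suc a) = y \<bullet> \<epsilon> (Suc a)" "a \<notin> set w"
    using word_coord_far[OF w(1)] a by simp_all
  then show ?case
    using psum_reflection[OF a Cons.prems(3), of ?z] Cons.IH[OF w Cons.prems(3)] by simp
qed simp

text \<open>
  On the coordinates which the word touches, \<open>\<sigma>(\<lambda> + \<rho>)\<close> agrees with \<open>\<lambda> + \<rho>\<close>.  There the surplus
  is 1, and neighbouring entries from position 2 on decrease by at most 1, so a swap
  costs no more than the surplus.
\<close>

lemma dominates_word_comp:
  assumes w: "set w \<subseteq> {2..n}" "nonconsecutive w" "n < r"
    and dom: "dominates \<sigma>"
    and same: "\<And>m. m \<in> {1..r} \<Longrightarrow> m \<le> Suc n \<Longrightarrow> \<sigma> shifted \<bullet> \<epsilon> m = shifted \<bullet> \<epsilon> m"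
  shows "dominates (refl_word r \<epsilon> w \<circ> \<sigma>)"
  unfolding dominates_def
proof
  fix m assume m: "m \<in> {1..r}"
  have w1: "set w \<subseteq> {1..<r}" using w by fastforce
  show "psum m (weyl_vector r \<epsilon>) \<le> psum m ((refl_word r \<epsilon> w \<circ> \<sigma>) shifted)"
  proof (cases "m \<in> set w")
    case False
    then show ?thesis
      using psum_word[OF w1 w(2), of m "\<sigma> shifted"] m dom unfolding dominates_def by simp
  next
    case True
    then have mn: "2 \<le> m" "m \<le> n" using w(1) by auto
    have "psum m (\<sigma> shifted) = psum m shifted"
      unfolding psum_def using same mn m by (intro sum.cong) auto
    moreover have "\<sigma> shifted \<bullet> \<epsilon> (Suc m) - \<sigma> shifted \<bullet> \<epsilon> m \<ge> - 1"
      using same[of m] same[of "Suc m"] mn w(3) shifted_coord[of m] shifted_coord[of "Suc m"] by auto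
    ultimately show ?thesis
      using psum_word[OF w1 w(2), of m "\<sigma> shifted"] m psum_shifted[OF m] True mn w(3) by simp
  qed
qed

lemma dominates_id: "dominates id"
  unfolding dominates_def using psum_shifted by simp

text \<open>
  For a word alone, apply \<open>dominates_word_comp\<close> to the identity.  Otherwise apply it to \<open>\<pi>\<close>, which
  only permutes the last three entries \<open>3, 2, 2\<close> and puts them in the order \<open>2, 3, 2\<close> or
  \<open>2, 2, 3\<close>; both dominate.
\<close>

lemma listed_imp_dominates:
  assumes "listed 2 \<sigma>" shows "\<sigma> \<in> weyl_group r \<epsilon> \<and> dominates \<sigma> \<and> (\<exists>q. perm_action \<sigma> q)"
  using assms[unfolded listed_def]
proof (elim disjE exE conjE)
  fix w assume w: "set w \<subseteq> {2..r - 1}" "nonconsecutive w" and \<sigma>: "\<sigma> = refl_word r \<epsilon> w"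
  have sub: "set w \<subseteq> {1..r}" "set w \<subseteq> {1..<r}" using w(1) r3 by fastforce+
  have "dominates (refl_word r \<epsilon> w \<circ> id)"
    by (rule dominates_word_comp[OF w _ dominates_id]) (use r3 in auto)
  then show ?thesis
    unfolding \<sigma> using weyl_group_word[OF sub(1)] perm_action_word[OF sub(2)] by simp
next
  fix w \<pi>
  assume r4: "2 + 2 \<le> r" and w: "set w \<subseteq> {2..r - 4}" "nonconsecutive w"
    and \<pi>: "\<pi> \<in> {s (r - 2) \<circ> s (r - 1), s (r - 1) \<circ> s (r - 2),
              s (r - 2) \<circ> s (r - 1) \<circ> s (r - 2)}"
    and \<sigma>: "\<sigma> = refl_word r \<epsilon> w \<circ> \<pi>"
  obtain a where r: "r = a + 2" "2 \<le> a"
    using r4 by (metis add_le_cancel_right le_add_diff_inverse2 le_trans le_add2)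
  have sub: "set w \<subseteq> {1..r}" "set w \<subseteq> {1..<r}" using w(1) r by fastforce+
  have in_W: "s a \<in> weyl_group r \<epsilon>" "s (Suc a) \<in> weyl_group r \<epsilon>"
    using weyl_group_reflection[of a] weyl_group_reflection[of "Suc a"] r by simp_all
  have ak: "perm_action (s a) (swap a)" "perm_action (s (Suc a)) (swap (Suc a))"
    by (rule perm_action_reflection; use r in simp)+
  have \<pi>': "\<pi> \<in> {s a \<circ> s (Suc a), s (Suc a) \<circ> s a, s a \<circ> s (Suc a) \<circ> s a}" using \<pi> r by simp
  then have \<pi>W: "\<pi> \<in> weyl_group r \<epsilon>" using in_W by (auto intro!: weyl_group_comp)
  have x: "shifted \<bullet> \<epsilon> a = 3" "shifted \<bullet> \<epsilon> (Suc a) = 2" "shifted \<bullet> \<epsilon> (a + 2) = 2"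
    using shifted_coord[of a] shifted_coord[of "Suc a"] shifted_coord[of "a + 2"] r by auto
  \<comment> \<open>The first of the last three entries becomes 2 and the first two add up to at least 4,
    in place of 3 and 5 in \<open>\<rho>\<close>; the surplus 1 makes up for this.\<close>
  obtain p where p: "perm_action \<pi> p" "\<And>i. i < a \<Longrightarrow> p i = i"
    "shifted \<bullet> \<epsilon> (p a) = 2" "shifted \<bullet> \<epsilon> (p a) + shifted \<bullet> \<epsilon> (p (Suc a)) \<ge> 4"
  proof -
    from \<pi>' consider "\<pi> = s a \<circ> s (Suc a)" | "\<pi> = s (Suc a) \<circ> s a"
      | "\<pi> = s a \<circ> s (Suc a) \<circ> s a" by blast
    then show thesis
    proof cases
      case 1
      have act: "perm_action \<pi> (swap (Suc a) \<circ> swap a)"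
        unfolding 1 by (intro perm_action_comp ak)
      show thesis by (rule that[OF act]) (use x in \<open>auto simp: transpose_def\<close>)
    next
      case 2
      have act: "perm_action \<pi> (swap a \<circ> swap (Suc a))"
        unfolding 2 by (intro perm_action_comp ak)
      show thesis by (rule that[OF act]) (use x in \<open>auto simp: transpose_def\<close>)
    next
      case 3
      have act: "perm_action \<pi> (swap a \<circ> (swap (Suc a) \<circ> swap a))"
        unfolding 3 by (intro perm_action_comp ak)
      show thesis by (rule that[OF act]) (use x in \<open>auto simp: transpose_def\<close>)
    qed
  qed
  have coord: "\<pi> shifted \<bullet> \<epsilon> i = shifted \<bullet> \<epsilon> (p i)" if "i \<in> {1..r}" for i
    using signed_perm_coord[OF p(1) that] by simp
  have low: "psum m (\<pi> shifted) = psum m shifted" if "m < a" for m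
    using that r p(2) by (intro psum_perm_action_fix[OF p(1)]) auto
  obtain b where b: "a = Suc b" "1 \<le> b" using r(2) by (cases a) auto
  have "psum m (weyl_vector r \<epsilon>) \<le> psum m (\<pi> shifted)" if m: "m \<in> {1..r}" for m
  proof -
    consider "m < a" | "m = a" | "m = Suc a" | "m = r" using m r by force
    then show ?thesis
    proof cases
      case 1
      then show ?thesis using low psum_shifted[OF m] by simp
    next
      case 2
      then show ?thesis
        using low[of b] psum_shifted[of b] coord[of a] weyl_vector_coord[of a] p(3) b r by simp
    next
      case 3
      then show ?thesis
        using low[of b] psum_shifted[of b] coord[of a] coord[of "Suc a"] weyl_vector_coord[of a]
          weyl_vector_coord[of "Suc a"] p(4) b r by simp
    next
      case 4
      then show ?thesis using psum_perm_action[OF p(1)] psum_shifted[OF m] by simp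
    qed
  qed
  then have "dominates \<pi>" unfolding dominates_def by blast
  then have "dominates \<sigma>"
    unfolding \<sigma> using coord p(2) r
    by (intro dominates_word_comp[OF w]) auto
  moreover obtain q where "perm_action (refl_word r \<epsilon> w) q" using perm_action_word[OF sub(2)] by blast
  then have "perm_action \<sigma> (p \<circ> q)" unfolding \<sigma> using p(1) by (rule perm_action_comp)
  moreover have "\<sigma> \<in> weyl_group r \<epsilon>"
    unfolding \<sigma> using weyl_group_word[OF sub(1)] \<pi>W by (rule weyl_group_comp)
  ultimately show ?thesis by blast
qed

lemma alternation_set_iff_listed:
  "\<sigma> \<in> alternation_set r \<epsilon> (\<Sum>i = 1..r. simple_root r \<epsilon> i) 0 \<longleftrightarrow> listed 2 \<sigma>"
proof -
  have "\<sigma> \<in> alternation_set r \<epsilon> (\<Sum>i = 1..r. simple_root r \<epsilon> i) 0 \<longleftrightarrow>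
    \<sigma> \<in> weyl_group r \<epsilon> \<and> partition_function r \<epsilon> (\<sigma> shifted - weyl_vector r \<epsilon>) > 0"
    unfolding alternation_set_def shifted_def by simp
  also have "\<dots> \<longleftrightarrow> listed 2 \<sigma>"
  proof
    assume *: "\<sigma> \<in> weyl_group r \<epsilon> \<and> partition_function r \<epsilon> (\<sigma> shifted - weyl_vector r \<epsilon>) > 0"
    then obtain q g where "signed_perm \<sigma> q g" using weyl_group_signed_perm by blast
    moreover have "dominates \<sigma>"
      using partition_function_pos_imp_psum_nonneg[OF conjunct2[OF *]]
      unfolding dominates_def by simp
    ultimately show "listed 2 \<sigma>" by (rule signed_perm_dominates_imp_listed)
  next
    assume "listed 2 \<sigma>"
    from listed_imp_dominates[OF this]
    show "\<sigma> \<in> weyl_group r \<epsilon> \<and> partition_function r \<epsilon> (\<sigma> shifted - weyl_vector r \<epsilon>) > 0"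
      using partition_function_pos_iff by blast
  qed
  finally show ?thesis .
qed

end

theorem theorem3p1:
  fixes r :: nat and \<epsilon> :: "nat \<Rightarrow> 'a::euclidean_space"
    and \<sigma> :: "'a \<Rightarrow> 'a" and s :: "nat \<Rightarrow> 'a \<Rightarrow> 'a" and lam :: 'a
  assumes "r \<ge> 3"
    and "std_basis r \<epsilon>"
    and "s = simple_reflection r \<epsilon>"
    and "lam = (\<Sum>i = 1..r. simple_root r \<epsilon> i)"
  shows "\<sigma> \<in> alternation_set r \<epsilon> lam 0 \<longleftrightarrow>
      \<sigma> = id
    \<or> (\<exists>is. is \<noteq> [] \<and> set is \<subseteq> {2..r - 1} \<and> nonconsecutive is \<and> \<sigma> = refl_word r \<epsilon> is)
    \<or> (r \<ge> 4 \<and>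
       (\<exists>is \<pi>. set is \<subseteq> {2..r - 4} \<and> nonconsecutive is \<and>
          \<pi> \<in> {s (r - 2) \<circ> s (r - 1),
               s (r - 1) \<circ> s (r - 2),
               s (r - 2) \<circ> s (r - 1) \<circ> s (r - 2)} \<and>
          \<sigma> = refl_word r \<epsilon> is \<circ> \<pi>))"
proof -
  interpret type_C r \<epsilon> using assms(1,2) by unfold_locales
  have "listed 2 \<sigma> \<longleftrightarrow> \<sigma> = id
    \<or> (\<exists>is. is \<noteq> [] \<and> set is \<subseteq> {2..r - 1} \<and> nonconsecutive is \<and> \<sigma> = refl_word r \<epsilon> is)
    \<or> (r \<ge> 4 \<and>
       (\<exists>is \<pi>. set is \<subseteq> {2..r - 4} \<and> nonconsecutive is \<and>
          \<pi> \<in> {s (r - 2) \<circ> s (r - 1),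
               s (r - 1) \<circ> s (r - 2),
               s (r - 2) \<circ> s (r - 1) \<circ> s (r - 2)} \<and>
          \<sigma> = refl_word r \<epsilon> is \<circ> \<pi>))" (is "_ \<longleftrightarrow> _ \<or> ?two \<or> ?three")
  proof -
    have "(\<exists>w. set w \<subseteq> {2..r - 1} \<and> nonconsecutive w \<and> \<sigma> = refl_word r \<epsilon> w) \<longleftrightarrow> \<sigma> = id \<or> ?two"
    proof
      assume "\<exists>w. set w \<subseteq> {2..r - 1} \<and> nonconsecutive w \<and> \<sigma> = refl_word r \<epsilon> w"
      then show "\<sigma> = id \<or> ?two" using refl_word_simps(1) by metis
    next
      assume "\<sigma> = id \<or> ?two"
      moreover have "set ([] :: nat list) \<subseteq> {2..r - 1}" by simp
      ultimately show "\<exists>w. set w \<subseteq> {2..r - 1} \<and> nonconsecutive w \<and> \<sigma> = refl_word r \<epsilon> w"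
        using refl_word_simps(1) nonconsecutive_Nil by metis
    qed
    moreover have "(2 + 2 \<le> r) = (4 \<le> r)" by simp
    ultimately show ?thesis unfolding listed_def assms(3) by blast
  qed
  then show ?thesis using alternation_set_iff_listed unfolding assms(4) by blast
qed

end
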